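(* Let $D$ be a Newton diagram in $2$ variables whose support $K$ is connected and has size $d$. Then $\#(D)\ge\frac{d+5}{2}$.
   Context: For $m\in\mathbb Z^n$ write $|m|=m_1+\dots+m_n$; $e_1,\dots,e_n$ is the standard basis. A Newton diagram in $n$ variables is a function $D\colon\mathbb Z^n\to\{0,P,N\}$ ($P,N$ formal symbols) whose support $K=D^{-1}(\{P,N\})$ is a finite nonempty subset of $\mathbb N_0^n$. For $a\in\mathbb Z^n$ let $E(a)=\{a,a-e_1,\dots,a-e_n\}$; $E(a)$ is a node of $D$ if the image $D(E(a))$ equals $\{P\}$, $\{N\}$, $\{0,P\}$ or $\{0,N\}$. $\#(D)$ is the number of $a\in\mathbb Z^n$ for which $E(a)$ is a node. Two distinct points $m,m'$ are adjacent if $m-m'\in\{\pm e_j\}\cup\{e_j-e_k: j\ne k\}$; $K$ is connected if any two points of $K$ are joined by a path of successively adjacent points of $K$. The size of $K$ is $k-|a|+1$ where $k=\max_{m\in K}|m|$ and $a_j=\min_{m\in K}m_j$. *)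

theory Defs
  imports Complex_Main
begin

datatype ndval = Zero | P | N

type_synonym pt = "int \<times> int"

definition support :: "(pt \<Rightarrow> ndval) \<Rightarrow> pt set" where
  "support D = {m. D m \<noteq> Zero}"

definition newton_diagram :: "(pt \<Rightarrow> ndval) \<Rightarrow> bool" where
  "newton_diagram D \<longleftrightarrow> finite (support D) \<and> support D \<noteq> {} \<and>
     (\<forall>m\<in>support D. fst m \<ge> 0 \<and> snd m \<ge> 0)"

definition Eset :: "pt \<Rightarrow> pt set" where
  "Eset a = {a, (fst a - 1, snd a), (fst a, snd a - 1)}"

definition is_node :: "(pt \<Rightarrow> ndval) \<Rightarrow> pt \<Rightarrow> bool" where
  "is_node D a \<longleftrightarrow> D ` Eset a \<in> {{P}, {N}, {Zero, P}, {Zero, N}}"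

definition num_nodes :: "(pt \<Rightarrow> ndval) \<Rightarrow> nat" where
  "num_nodes D = card {a. is_node D a}"

definition adjacent :: "pt \<Rightarrow> pt \<Rightarrow> bool" where
  "adjacent m m' \<longleftrightarrow> m \<noteq> m' \<and>
     (fst m - fst m', snd m - snd m') \<in> {(1,0), (-1,0), (0,1), (0,-1), (1,-1), (-1,1)}"

definition connected_pts :: "pt set \<Rightarrow> bool" where
  "connected_pts K \<longleftrightarrow> (\<forall>m\<in>K. \<forall>m'\<in>K.
     \<exists>ps. ps \<noteq> [] \<and> hd ps = m \<and> last ps = m' \<and> set ps \<subseteq> K \<and>
          (\<forall>i. Suc i < length ps \<longrightarrow> adjacent (ps ! i) (ps ! Suc i)))"

definition size_pts :: "pt set \<Rightarrow> int" where
  "size_pts K = Max ((\<lambda>m. fst m + snd m) ` K) - (Min (fst ` K) + Min (snd ` K)) + 1"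

end

theory Submission
  imports Defs
begin

text \<open>The points of the plane form a triangular lattice in which every edge lies in exactly one
  down triangle \<open>{a, a - e\<^sub>1, a - e\<^sub>2}\<close> and one up triangle \<open>{a, a + e\<^sub>1, a + e\<^sub>2}\<close>, and every
  point in three of each. Hence a sum of point and edge weights has the same value over all down
  triangles as over all up triangles. For suitable weights this gives
  \<open>6 #(D) \<ge> 5 D\<^sub>1 + U\<^sub>1\<close>, where \<open>D\<^sub>1\<close> and \<open>U\<^sub>1\<close> count the down and up triangles
  that meet \<open>K\<close> in a single point, so the signs are no longer involved.

  The quantity \<open>2 D\<^sub>1 + U\<^sub>1\<close> does not increase when the third vertex of an up triangle with
  two vertices in \<open>K\<close> is added to \<open>K\<close>. For connected \<open>K\<close> such additions fill the whole
  bounding triangle, where the value is \<open>3 d + 6\<close>. Three extreme points of \<open>K\<close> show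
  \<open>D\<^sub>1 \<ge> 3\<close>, so \<open>6 #(D) \<ge> 3 d + 15\<close>.\<close>

section \<open>Lattice triangles that meet a set in one point\<close>

definition exactly_one :: "bool \<Rightarrow> bool \<Rightarrow> bool \<Rightarrow> bool" where
  "exactly_one p q r \<longleftrightarrow> (p \<and> \<not> q \<and> \<not> r) \<or> (\<not> p \<and> q \<and> \<not> r) \<or> (\<not> p \<and> \<not> q \<and> r)"

text \<open>The three points are those of \<open>Eset a\<close>, so for \<open>K = support D\<close>
  such an \<open>a\<close> is a node whatever the sign.\<close>

definition single_down :: "pt set \<Rightarrow> pt \<Rightarrow> bool" where
  "single_down K a \<longleftrightarrow>
     exactly_one (a \<in> K) ((fst a - 1, snd a) \<in> K) ((fst a, snd a - 1) \<in> K)"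

definition single_up :: "pt set \<Rightarrow> pt \<Rightarrow> bool" where
  "single_up K a \<longleftrightarrow>
     exactly_one (a \<in> K) ((fst a + 1, snd a) \<in> K) ((fst a, snd a + 1) \<in> K)"

lemma finite_single_down:
  assumes "finite K"
  shows "finite {a. single_down K a}"
proof (rule finite_subset)
  show "{a. single_down K a}
      \<subseteq> K \<union> (\<lambda>(x, y). (x + 1, y)) ` K \<union> (\<lambda>(x, y). (x, y + 1)) ` K"
    by (force simp: image_iff single_down_def exactly_one_def)
qed (use assms in auto)

lemma finite_single_up:
  assumes "finite K"
  shows "finite {a. single_up K a}"
proof (rule finite_subset)
  show "{a. single_up K a}
      \<subseteq> K \<union> (\<lambda>(x, y). (x - 1, y)) ` K \<union> (\<lambda>(x, y). (x, y - 1)) ` K"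
    by (force simp: image_iff single_up_def exactly_one_def)
qed (use assms in auto)

lemma card_eq_sum_of_bool:
  assumes "finite A" "{a. Q a} \<subseteq> A"
  shows "int (card {a. Q a}) = (\<Sum>a\<in>A. of_bool (Q a))"
proof -
  have "A \<inter> {a. Q a} = {a. Q a}" using assms(2) by blast
  then show ?thesis using assms(1) by simp
qed


subsection \<open>Comparing nodes with triangles that meet the support once\<close>

definition point_weight :: "ndval \<Rightarrow> int" where
  "point_weight p = (if p = Zero then 0 else 1)"

text \<open>The weights of points and edges are the only ones for which both
  \<open>triangle_weight_le_node\<close> and \<open>single_le_triangle_weight\<close> hold.\<close>

definition edge_weight :: "ndval \<Rightarrow> ndval \<Rightarrow> int" where
  "edge_weight p q = (if p = Zero \<or> q = Zero then 0 else if p = q then 1 else - 2)"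

definition triangle_weight :: "ndval \<Rightarrow> ndval \<Rightarrow> ndval \<Rightarrow> int" where
  "triangle_weight p q r = point_weight p + point_weight q + point_weight r
     + edge_weight p q + edge_weight p r + edge_weight q r"

text \<open>A triangle weighs 0, 1, 3 or 6 if it has none, one, two or three nonzero entries of one
  sign, and 0 as soon as both signs occur. The next lemma rests on the same list.\<close>

lemma single_le_triangle_weight:
  "of_bool (exactly_one (p \<noteq> Zero) (q \<noteq> Zero) (r \<noteq> Zero)) \<le> triangle_weight p q r"
  by (cases p; cases q; cases r)
     (simp_all add: exactly_one_def triangle_weight_def point_weight_def edge_weight_def)

lemma triangle_weight_le_node:
  "5 * of_bool (exactly_one (p \<noteq> Zero) (q \<noteq> Zero) (r \<noteq> Zero)) + triangle_weight p q r
     \<le> 6 * of_bool ({p, q, r} \<in> {{P}, {N}, {Zero, P}, {Zero, N}})"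
  by (cases p; cases q; cases r)
     (simp_all add: exactly_one_def triangle_weight_def point_weight_def edge_weight_def insert_commute)

text \<open>A finite window stands in for the whole plane: the shift alters the range of summation
  only at points where \<open>f\<close> vanishes.\<close>

lemma sum_translate:
  fixes f :: "int \<times> int \<Rightarrow> int"
  assumes "finite A" and "\<And>x y. f (x, y) \<noteq> 0 \<Longrightarrow> (x, y) \<in> A \<and> (x - u, y - v) \<in> A"
  shows "(\<Sum>a\<in>A. f (fst a + u, snd a + v)) = sum f A"
proof -
  let ?t = "\<lambda>a. (fst a + u, snd a + v)"
  have inj: "inj_on ?t A" by (auto simp: inj_on_def)
  have "(\<Sum>a\<in>A. f (?t a)) = sum f (?t ` A)"
    using sum.reindex[OF inj, of f] by (simp add: o_def)
  also have "\<dots> = sum f A"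
  proof (rule sum.mono_neutral_cong)
    fix i assume "i \<in> A - ?t ` A"
    then have "(fst i - u, snd i - v) \<notin> A" by (force simp: image_iff)
    then show "f i = 0" using assms(2)[of "fst i" "snd i"] by auto
  next
    fix i assume "i \<in> ?t ` A - A"
    then show "f i = 0" using assms(2)[of "fst i" "snd i"] by auto
  qed (use assms(1) in auto)
  finally show ?thesis .
qed

lemma finite_imp_box:
  fixes K :: "(int \<times> int) set"
  assumes "finite K"
  obtains M where "\<And>x y. (x, y) \<in> K \<Longrightarrow> \<bar>x\<bar> \<le> M \<and> \<bar>y\<bar> \<le> M"
proof
  fix x y assume xy: "(x, y) \<in> K"
  have fin: "finite ((\<lambda>a. max \<bar>fst a\<bar> \<bar>snd a\<bar>) ` K)" using assms by simp
  have "max \<bar>x\<bar> \<bar>y\<bar> \<le> Max ((\<lambda>a. max \<bar>fst a\<bar> \<bar>snd a\<bar>) ` K)"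
    using xy by (intro Max_ge[OF fin]) force
  then show "\<bar>x\<bar> \<le> Max ((\<lambda>a. max \<bar>fst a\<bar> \<bar>snd a\<bar>) ` K) \<and> \<bar>y\<bar> \<le> Max ((\<lambda>a. max \<bar>fst a\<bar> \<bar>snd a\<bar>) ` K)"
    by simp
qed

lemma num_nodes_ge_single:
  assumes fin: "finite (support D)"
  shows "5 * int (card {a. single_down (support D) a}) + int (card {a. single_up (support D) a})
     \<le> 6 * int (num_nodes D)"
proof -
  let ?K = "support D"
  obtain M where M: "\<And>x y. (x, y) \<in> ?K \<Longrightarrow> \<bar>x\<bar> \<le> M \<and> \<bar>y\<bar> \<le> M"
    using finite_imp_box[OF fin] by blast
  have nz: "\<bar>x\<bar> \<le> M \<and> \<bar>y\<bar> \<le> M" if "D (x, y) \<noteq> Zero" for x y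
    using M that by (simp add: support_def)
  \<comment> \<open>The margin leaves room for the index of every triangle that meets the support,
    also after the unit shifts below.\<close>
  define A where "A = {- M - 2 .. M + 2} \<times> {- M - 2 .. M + 2}"
  have finA: "finite A" by (simp add: A_def)
  have inA: "(x, y) \<in> A" if "D (u, v) \<noteq> Zero" "\<bar>x - u\<bar> \<le> 2" "\<bar>y - v\<bar> \<le> 2" for x y u v
    using nz[OF that(1)] that(2,3) by (auto simp: A_def)
  define wd where "wd a = triangle_weight (D a) (D (fst a - 1, snd a)) (D (fst a, snd a - 1))" for a
  define wu where "wu a = triangle_weight (D a) (D (fst a + 1, snd a)) (D (fst a, snd a + 1))" for a
  define f where "f a = point_weight (D a)" for a
  \<comment> \<open>One function per edge direction, indexed by the down triangle on the edge. The
    up triangle on the same edge has its index lower by (1,0), (0,1) and (1,1) respectively, whence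
    the shifts below.\<close>
  define g1 where "g1 a = edge_weight (D a) (D (fst a - 1, snd a))" for a
  define g2 where "g2 a = edge_weight (D a) (D (fst a, snd a - 1))" for a
  define g3 where "g3 a = edge_weight (D (fst a - 1, snd a)) (D (fst a, snd a - 1))" for a
  have f: "(\<Sum>a\<in>A. f (fst a + u, snd a + v)) = sum f A" if "\<bar>u\<bar> \<le> 1" "\<bar>v\<bar> \<le> 1" for u v
    by (rule sum_translate[OF finA])
       (use that in \<open>auto simp: f_def point_weight_def intro!: inA split: if_splits\<close>)
  have g1: "(\<Sum>a\<in>A. g1 (fst a + 1, snd a + 0)) = sum g1 A"
    by (rule sum_translate[OF finA])
       (auto simp: g1_def edge_weight_def intro: inA split: if_splits)
  have g2: "(\<Sum>a\<in>A. g2 (fst a + 0, snd a + 1)) = sum g2 A"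
    by (rule sum_translate[OF finA])
       (auto simp: g2_def edge_weight_def intro: inA split: if_splits)
  have g3: "(\<Sum>a\<in>A. g3 (fst a + 1, snd a + 1)) = sum g3 A"
    by (rule sum_translate[OF finA])
       (auto simp: g3_def edge_weight_def intro: inA split: if_splits)
  \<comment> \<open>\<open>wu\<close> lists the two ends of an edge in the opposite order.\<close>
  have sym: "edge_weight p q = edge_weight q p" for p q by (auto simp: edge_weight_def)
  have "sum wd A = (\<Sum>a\<in>A. f (fst a + 0, snd a + 0) + f (fst a + (-1), snd a + 0)
      + f (fst a + 0, snd a + (-1)) + g1 a + g2 a + g3 a)"
    by (simp add: wd_def triangle_weight_def f_def g1_def g2_def g3_def)
  also have "\<dots> = 3 * sum f A + sum g1 A + sum g2 A + sum g3 A"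
    using f[of 0 0] f[of "-1" 0] f[of 0 "-1"] by (simp add: sum.distrib)
  also have "\<dots> = (\<Sum>a\<in>A. f (fst a + 0, snd a + 0) + f (fst a + 1, snd a + 0)
      + f (fst a + 0, snd a + 1) + g1 (fst a + 1, snd a + 0) + g2 (fst a + 0, snd a + 1)
      + g3 (fst a + 1, snd a + 1))"
    using f[of 0 0] f[of 1 0] f[of 0 1] g1 g2 g3 by (simp add: sum.distrib)
  also have "\<dots> = sum wu A"
    by (rule sum.cong) (auto simp: wu_def triangle_weight_def f_def g1_def g2_def g3_def sym)
  finally have weights: "sum wd A = sum wu A" .
  have nodeA: "{a. is_node D a} \<subseteq> A"
  proof
    fix a assume "a \<in> {a. is_node D a}"
    then have "D a \<noteq> Zero \<or> D (fst a - 1, snd a) \<noteq> Zero \<or> D (fst a, snd a - 1) \<noteq> Zero"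
      by (rule contrapos_pp) (auto simp: is_node_def Eset_def)
    then show "a \<in> A" by (cases a) (auto simp: A_def dest!: nz)
  qed
  have downA: "{a. single_down ?K a} \<subseteq> A"
    by (auto simp: single_down_def exactly_one_def support_def A_def dest!: nz)
  have upA: "{a. single_up ?K a} \<subseteq> A"
    by (auto simp: single_up_def exactly_one_def support_def A_def dest!: nz)
  have "5 * int (card {a. single_down ?K a}) + sum wd A
      = (\<Sum>a\<in>A. 5 * of_bool (single_down ?K a) + wd a)"
    by (simp only: card_eq_sum_of_bool[OF finA downA] sum.distrib sum_distrib_left)
  also have "\<dots> \<le> (\<Sum>a\<in>A. 6 * of_bool (is_node D a))"
  proof (rule sum_mono)
    fix a
    show "5 * of_bool (single_down ?K a) + wd a \<le> 6 * of_bool (is_node D a)"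
      using triangle_weight_le_node[of "D a" "D (fst a - 1, snd a)" "D (fst a, snd a - 1)"]
      unfolding single_down_def support_def wd_def is_node_def Eset_def image_insert image_empty
        mem_Collect_eq .
  qed
  also have "\<dots> = 6 * int (num_nodes D)"
    unfolding num_nodes_def card_eq_sum_of_bool[OF finA nodeA] sum_distrib_left ..
  finally have 1: "5 * int (card {a. single_down ?K a}) + sum wd A \<le> 6 * int (num_nodes D)" .
  have "int (card {a. single_up ?K a}) \<le> sum wu A"
    unfolding card_eq_sum_of_bool[OF finA upA]
  proof (rule sum_mono)
    fix a
    show "of_bool (single_up ?K a) \<le> wu a"
      using single_le_triangle_weight[of "D a" "D (fst a + 1, snd a)" "D (fst a, snd a + 1)"]
      unfolding single_up_def support_def wu_def mem_Collect_eq .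
  qed
  with 1 weights show ?thesis by linarith
qed


subsection \<open>Filling up the bounding triangle\<close>

text \<open>Each of three linear functionals is maximised over \<open>K\<close>. It is larger at the
  two other vertices of a suitable down triangle through the maximiser, so these lie outside
  \<open>K\<close>.\<close>

lemma three_le_card_single_down:
  assumes fin: "finite K" and ne: "K \<noteq> {}"
  shows "3 \<le> card {a. single_down K a}"
proof -
  have ex: "\<exists>m\<in>K. \<forall>n\<in>K. h n \<le> h m" for h :: "pt \<Rightarrow> int"
  proof -
    have "Max (h ` K) \<in> h ` K" using fin ne by (intro Max_in) auto
    then obtain m where "m \<in> K" "h m = Max (h ` K)" by auto
    then show ?thesis using fin by (metis Max_ge finite_imageI imageI)
  qed
  obtain x1 y1 where m1: "(x1, y1) \<in> K" "\<And>x y. (x, y) \<in> K \<Longrightarrow> x1 + y1 \<le> x + y"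
    using ex[of "\<lambda>a. - fst a - snd a"] by fastforce
  obtain x2 y2 where m2: "(x2, y2) \<in> K" "\<And>x y. (x, y) \<in> K \<Longrightarrow> 2 * x + y \<le> 2 * x2 + y2"
    using ex[of "\<lambda>a. 2 * fst a + snd a"] by fastforce
  obtain x3 y3 where m3: "(x3, y3) \<in> K" "\<And>x y. (x, y) \<in> K \<Longrightarrow> x + 2 * y \<le> x3 + 2 * y3"
    using ex[of "\<lambda>a. fst a + 2 * snd a"] by fastforce
  have 1: "single_down K (x1, y1)"
    using m1(1) m1(2)[of "x1 - 1" y1] m1(2)[of x1 "y1 - 1"]
    by (auto simp: single_down_def exactly_one_def)
  have n2: "(x2 + 1, y2) \<notin> K" "(x2 + 1, y2 - 1) \<notin> K"
    using m2(2)[of "x2 + 1" y2] m2(2)[of "x2 + 1" "y2 - 1"] by auto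
  have n3: "(x3, y3 + 1) \<notin> K" "(x3 - 1, y3 + 1) \<notin> K"
    using m3(2)[of x3 "y3 + 1"] m3(2)[of "x3 - 1" "y3 + 1"] by auto
  have 2: "single_down K (x2 + 1, y2)"
    using m2(1) n2 by (auto simp: single_down_def exactly_one_def)
  have 3: "single_down K (x3, y3 + 1)"
    using m3(1) n3 by (auto simp: single_down_def exactly_one_def)
  \<comment> \<open>The coordinate sum of the first index is minimal on \<open>K\<close>, while each
    other index exceeds by one the sum of a point of \<open>K\<close>. If the last two agreed,
    \<open>(x2, y2)\<close> would be the excluded point \<open>(x3 - 1, y3 + 1)\<close>.\<close>
  have d: "(x1, y1) \<noteq> (x2 + 1, y2)" "(x1, y1) \<noteq> (x3, y3 + 1)" "(x2 + 1, y2) \<noteq> (x3, y3 + 1)"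
    using m1(2)[OF m2(1)] m1(2)[OF m3(1)] n3 m2(1) by auto
  have "card {(x1, y1), (x2 + 1, y2), (x3, y3 + 1)} = 3" using d by simp
  moreover have "card {(x1, y1), (x2 + 1, y2), (x3, y3 + 1)} \<le> card {a. single_down K a}"
    using 1 2 3 by (intro card_mono finite_single_down fin) auto
  ultimately show ?thesis by simp
qed

text \<open>What remains of the bound in \<open>num_nodes_ge_single\<close> after three copies of
  the down count are set aside for \<open>three_le_card_single_down\<close>.\<close>

definition exposure :: "pt set \<Rightarrow> int" where
  "exposure K = 2 * int (card {a. single_down K a}) + int (card {a. single_up K a})"

text \<open>The cases take \<open>m\<close> as lower left, right and top corner of an up triangle.
  As \<open>m\<close> may lie in \<open>K\<close>, closure of \<open>K\<close> reads
  \<open>completes_up K m \<Longrightarrow> m \<in> K\<close>.\<close>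

definition completes_up :: "pt set \<Rightarrow> pt \<Rightarrow> bool" where
  "completes_up K m \<longleftrightarrow> (case m of (x, y) \<Rightarrow>
     (x + 1, y) \<in> K \<and> (x, y + 1) \<in> K \<or>
     (x - 1, y) \<in> K \<and> (x - 1, y + 1) \<in> K \<or>
     (x, y - 1) \<in> K \<and> (x + 1, y - 1) \<in> K)"

section \<open>The change of exposure when one point is added\<close>

lemma card_diff_local:
  assumes "finite {a. Q a}" "finite {a. R a}" "finite S" "\<And>a. a \<notin> S \<Longrightarrow> Q a = R a"
  shows "int (card {a. Q a}) - int (card {a. R a}) = (\<Sum>a\<in>S. of_bool (Q a) - of_bool (R a))"
proof -
  define A where "A = {a. Q a} \<union> {a. R a} \<union> S"
  have A: "finite A" "{a. Q a} \<subseteq> A" "{a. R a} \<subseteq> A" "S \<subseteq> A"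
    using assms(1-3) by (auto simp: A_def)
  have "int (card {a. Q a}) - int (card {a. R a}) = (\<Sum>a\<in>A. of_bool (Q a) - of_bool (R a))"
    by (simp only: card_eq_sum_of_bool[OF A(1,2)] card_eq_sum_of_bool[OF A(1,3)] sum_subtractf)
  also have "\<dots> = (\<Sum>a\<in>S. of_bool (Q a) - of_bool (R a))"
    by (rule sum.mono_neutral_right) (use A assms(4) in auto)
  finally show ?thesis .
qed

text \<open>The variables tell which of the six neighbours of the new point, named by compass direction,
  belong to the set.\<close>

lemma exposure_change_nonpos:
  assumes "e \<and> n \<or> w \<and> nw \<or> s \<and> se"
  shows "2 * ((of_bool (exactly_one True w s) - of_bool (exactly_one False w s))
        + ((of_bool (exactly_one e True se) - of_bool (exactly_one e False se))
        + (of_bool (exactly_one n nw True) - of_bool (exactly_one n nw False))))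
      + ((of_bool (exactly_one True e n) - of_bool (exactly_one False e n))
        + ((of_bool (exactly_one w True nw) - of_bool (exactly_one w False nw))
        + (of_bool (exactly_one s se True) - of_bool (exactly_one s se False)))) \<le> (0 :: int)"
  using assms
  by (cases e; cases n; cases w; cases nw; cases s; cases se) (simp_all add: exactly_one_def)

lemma exposure_insert_le:
  assumes fin: "finite K" and m: "m \<notin> K" "completes_up K m"
  shows "exposure (insert m K) \<le> exposure K"
proof -
  obtain x y where xy: "m = (x, y)" by (cases m)
  let ?L = "insert m K"
  \<comment> \<open>The new point lies in just three down and three up triangles; the listed points
    are their indices.\<close>
  have loc_down: "single_down ?L a = single_down K a" if "a \<notin> {(x, y), (x + 1, y), (x, y + 1)}" for a
    using that by (cases a) (auto simp: single_down_def xy)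
  have loc_up: "single_up ?L a = single_up K a" if "a \<notin> {(x, y), (x - 1, y), (x, y - 1)}" for a
    using that by (cases a) (auto simp: single_up_def xy)
  have "int (card {a. single_down ?L a}) - int (card {a. single_down K a})
      = (\<Sum>a\<in>{(x, y), (x + 1, y), (x, y + 1)}. of_bool (single_down ?L a) - of_bool (single_down K a))"
    by (intro card_diff_local finite_single_down loc_down) (use fin in simp_all)
  moreover have "int (card {a. single_up ?L a}) - int (card {a. single_up K a})
      = (\<Sum>a\<in>{(x, y), (x - 1, y), (x, y - 1)}. of_bool (single_up ?L a) - of_bool (single_up K a))"
    by (intro card_diff_local finite_single_up loc_up) (use fin in simp_all)
  moreover have "2 * (\<Sum>a\<in>{(x, y), (x + 1, y), (x, y + 1)}.
        of_bool (single_down ?L a) - of_bool (single_down K a))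
      + (\<Sum>a\<in>{(x, y), (x - 1, y), (x, y - 1)}.
        of_bool (single_up ?L a) - of_bool (single_up K a)) \<le> (0 :: int)"
    using exposure_change_nonpos[of "(x + 1, y) \<in> K" "(x, y + 1) \<in> K" "(x - 1, y) \<in> K"
        "(x - 1, y + 1) \<in> K" "(x, y - 1) \<in> K" "(x + 1, y - 1) \<in> K"] m
    by (simp add: single_down_def single_up_def completes_up_def xy)
  ultimately show ?thesis unfolding exposure_def by linarith
qed

section \<open>Full triangles, and their growth inside a closed set\<close>

definition up_triangle :: "int \<Rightarrow> int \<Rightarrow> int \<Rightarrow> pt set" where
  "up_triangle a b k = {(x, y). a \<le> x \<and> b \<le> y \<and> x + y \<le> k}"

lemma finite_up_triangle: "finite (up_triangle a b k)"
  by (rule finite_subset[of _ "{a..k - b} \<times> {b..k - a}"]) (auto simp: up_triangle_def)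

text \<open>Three single down triangles contribute 6. Along each side, every one of the
  \<open>k - a - b + 1\<close> boundary points is the only point of an up triangle that sticks out
  across that side.\<close>

lemma exposure_up_triangle_ge:
  assumes "a + b \<le> k"
  shows "3 * (k - a - b + 1) + 6 \<le> exposure (up_triangle a b k)"
proof -
  let ?B = "up_triangle a b k"
  let ?n = "nat (k - a - b + 1)"
  have "(a, b) \<in> ?B" using assms by (simp add: up_triangle_def)
  then have d: "3 \<le> card {a. single_down ?B a}"
    by (intro three_le_card_single_down finite_up_triangle) auto
  define X where "X = (\<lambda>y. (a - 1, y)) ` {b..k - a}"
  define Y where "Y = (\<lambda>x. (x, b - 1)) ` {a..k - b}"
  define Z where "Z = (\<lambda>x. (x, k - x)) ` {a..k - b}"
  have "card X = nat (k - a + 1 - b)" unfolding X_def by (subst card_image) (auto simp: inj_on_def)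
  moreover have "card Y = nat (k - b + 1 - a)" unfolding Y_def by (subst card_image) (auto simp: inj_on_def)
  moreover have "card Z = nat (k - b + 1 - a)" unfolding Z_def by (subst card_image) (auto simp: inj_on_def)
  ultimately have c: "card X = ?n" "card Y = ?n" "card Z = ?n" by (simp_all add: algebra_simps)
  have fin: "finite X" "finite Y" "finite Z" by (simp_all add: X_def Y_def Z_def)
  have "X \<inter> Y = {}" "(X \<union> Y) \<inter> Z = {}" by (auto simp: X_def Y_def Z_def)
  then have "card (X \<union> Y \<union> Z) = 3 * ?n"
    using fin c by (simp add: card_Un_disjoint)
  moreover have "X \<union> Y \<union> Z \<subseteq> {a. single_up ?B a}"
    by (auto simp: X_def Y_def Z_def single_up_def exactly_one_def up_triangle_def)
  ultimately have "3 * ?n \<le> card {a. single_up ?B a}"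
    by (metis card_mono finite_single_up finite_up_triangle)
  with d assms show ?thesis by (simp add: exposure_def)
qed

lemma interval_propagate:
  fixes Q :: "int \<Rightarrow> bool"
  assumes "Q i" "l \<le> i" "i \<le> u" "l \<le> j" "j \<le> u"
    and up: "\<And>t. l \<le> t \<Longrightarrow> t < u \<Longrightarrow> Q t \<Longrightarrow> Q (t + 1)"
    and down: "\<And>t. l < t \<Longrightarrow> t \<le> u \<Longrightarrow> Q t \<Longrightarrow> Q (t - 1)"
  shows "Q j"
proof (cases "i \<le> j")
  case True
  then have "j \<le> u \<longrightarrow> Q j"
    by (induction rule: int_ge_induct) (use assms in auto)
  then show ?thesis using assms by blast
next
  case False
  then have "j \<le> i" by simp
  then have "l \<le> j \<longrightarrow> Q j"
    by (induction rule: int_le_induct) (use assms in auto)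
  then show ?thesis using assms by blast
qed

text \<open>The point \<open>m\<close> lies on the line next to one side. A point of that line and a
  suitable point of the side are two corners of an up triangle whose third corner is the next point
  of the line, so closure fills the line in both directions from \<open>m\<close>.\<close>

lemma up_triangle_grow:
  assumes closed: "\<And>m. completes_up L m \<Longrightarrow> m \<in> L"
    and sub: "up_triangle a b k \<subseteq> L"
    and p: "p \<in> up_triangle a b k"
    and m: "m \<in> L" "m \<notin> up_triangle a b k" "adjacent p m"
  obtains a' b' k' where "up_triangle a' b' k' \<subseteq> L" "up_triangle a b k \<subseteq> up_triangle a' b' k'"
    "m \<in> up_triangle a' b' k'"
proof -
  obtain px py where pxy: "p = (px, py)" by (cases p)
  obtain x y where mxy: "m = (x, y)" by (cases m)
  have L: "(u, v) \<in> L" if "a \<le> u" "b \<le> v" "u + v \<le> k" for u v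
    using sub that by (auto simp: up_triangle_def)
  have c1: "(u, v + 1) \<in> L" if "(u, v) \<in> L" "(u + 1, v) \<in> L" for u v
    using closed[of "(u, v + 1)"] that by (simp add: completes_up_def)
  have c2: "(u + 1, v) \<in> L" if "(u, v) \<in> L" "(u, v + 1) \<in> L" for u v
    using closed[of "(u + 1, v)"] that by (simp add: completes_up_def)
  have c3: "(u, v) \<in> L" if "(u + 1, v) \<in> L" "(u, v + 1) \<in> L" for u v
    using closed[of "(u, v)"] that by (simp add: completes_up_def)
  have pT: "a \<le> px" "b \<le> py" "px + py \<le> k" using p pxy by (auto simp: up_triangle_def)
  have adj: "(px - x, py - y) \<in> {(1,0), (-1,0), (0,1), (0,-1), (1,-1), (-1,1)}"
    using m(3) by (simp add: adjacent_def pxy mxy)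
  have out: "\<not> (a \<le> x \<and> b \<le> y \<and> x + y \<le> k)"
    using m(2) mxy by (simp add: up_triangle_def)
  \<comment> \<open>A lattice step out of the triangle crosses exactly one side, and by one
    unit.\<close>
  have "x = a - 1 \<and> b \<le> y \<and> x + y \<le> k" if "x < a"
    using adj pT that by auto
  moreover have "y = b - 1 \<and> a \<le> x \<and> x + y \<le> k" if "y < b"
    using adj pT that by auto
  moreover have "x + y = k + 1 \<and> a \<le> x \<and> b \<le> y" if "x + y > k"
    using adj pT that by auto
  ultimately consider (left) "x = a - 1" "b \<le> y" "x + y \<le> k"
    | (bottom) "y = b - 1" "a \<le> x" "x + y \<le> k"
    | (right) "x + y = k + 1" "a \<le> x" "b \<le> y"
    using out by (meson not_le)
  then show ?thesis
  proof cases
    case left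
    \<comment> \<open>The new side has one point more than the old one, hence the upper end
      \<open>k - a + 1\<close>.\<close>
    have col: "(a - 1, v) \<in> L" if "b \<le> v" "v \<le> k - a + 1" for v
    proof (rule interval_propagate[where Q = "\<lambda>v. (a - 1, v) \<in> L" and i = y and l = b and u = "k - a + 1"])
      fix t assume "b \<le> t" "t < k - a + 1" "(a - 1, t) \<in> L"
      then show "(a - 1, t + 1) \<in> L" using c1[of "a - 1" t] L[of a t] by simp
    next
      fix t assume "b < t" "t \<le> k - a + 1" "(a - 1, t) \<in> L"
      then show "(a - 1, t - 1) \<in> L" using c3[of "a - 1" "t - 1"] L[of a "t - 1"] by simp
    qed (use left m(1) mxy that in auto)
    have "(u, v) \<in> L" if "a - 1 \<le> u" "b \<le> v" "u + v \<le> k" for u v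
      using col[of v] L[of u v] that by (cases "u = a - 1") auto
    then have "up_triangle (a - 1) b k \<subseteq> L" by (auto simp: up_triangle_def)
    moreover have "up_triangle a b k \<subseteq> up_triangle (a - 1) b k" "m \<in> up_triangle (a - 1) b k"
      using left mxy by (auto simp: up_triangle_def)
    ultimately show ?thesis using that by blast
  next
    case bottom
    have row: "(u, b - 1) \<in> L" if "a \<le> u" "u \<le> k - b + 1" for u
    proof (rule interval_propagate[where Q = "\<lambda>u. (u, b - 1) \<in> L" and i = x and l = a and u = "k - b + 1"])
      fix t assume "a \<le> t" "t < k - b + 1" "(t, b - 1) \<in> L"
      then show "(t + 1, b - 1) \<in> L" using c2[of t "b - 1"] L[of t b] by simp
    next
      fix t assume "a < t" "t \<le> k - b + 1" "(t, b - 1) \<in> L"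
      then show "(t - 1, b - 1) \<in> L" using c3[of "t - 1" "b - 1"] L[of "t - 1" b] by simp
    qed (use bottom m(1) mxy that in auto)
    have "(u, v) \<in> L" if "a \<le> u" "b - 1 \<le> v" "u + v \<le> k" for u v
      using row[of u] L[of u v] that by (cases "v = b - 1") auto
    then have "up_triangle a (b - 1) k \<subseteq> L" by (auto simp: up_triangle_def)
    moreover have "up_triangle a b k \<subseteq> up_triangle a (b - 1) k" "m \<in> up_triangle a (b - 1) k"
      using bottom mxy by (auto simp: up_triangle_def)
    ultimately show ?thesis using that by blast
  next
    case right
    have diag: "(u, k + 1 - u) \<in> L" if "a \<le> u" "u \<le> k + 1 - b" for u
    proof (rule interval_propagate[where Q = "\<lambda>u. (u, k + 1 - u) \<in> L" and i = x and l = a and u = "k + 1 - b"])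
      fix t assume "a \<le> t" "t < k + 1 - b" "(t, k + 1 - t) \<in> L"
      then show "(t + 1, k + 1 - (t + 1)) \<in> L" using c2[of t "k - t"] L[of t "k - t"]
        by (simp add: algebra_simps)
    next
      fix t assume "a < t" "t \<le> k + 1 - b" "(t, k + 1 - t) \<in> L"
      then show "(t - 1, k + 1 - (t - 1)) \<in> L"
        using c1[of "t - 1" "k + 1 - t"] L[of "t - 1" "k + 1 - t"] by (simp add: algebra_simps)
    next
      show "(x, k + 1 - x) \<in> L" using right m(1) mxy by (simp add: eq_diff_eq[symmetric] add.commute)
    qed (use right that in auto)
    have "(u, v) \<in> L" if "a \<le> u" "b \<le> v" "u + v \<le> k + 1" for u v
    proof (cases "u + v = k + 1")
      case True
      then have "v = k + 1 - u" by simp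
      then show ?thesis using diag[of u] that by simp
    qed (use L[of u v] that in auto)
    then have "up_triangle a b (k + 1) \<subseteq> L" by (auto simp: up_triangle_def)
    moreover have "up_triangle a b k \<subseteq> up_triangle a b (k + 1)" "m \<in> up_triangle a b (k + 1)"
      using right mxy by (auto simp: up_triangle_def)
    ultimately show ?thesis using that by blast
  qed
qed

text \<open>An up triangle in \<open>L\<close> that contains \<open>m0\<close> and is maximal cannot
  be left by a lattice step within \<open>L\<close>, as it would grow. So it contains every path in
  \<open>K\<close> from \<open>m0\<close>.\<close>

lemma connected_subset_up_triangle:
  assumes K: "connected_pts K" "K \<noteq> {}" and L: "K \<subseteq> L" "finite L"
    and closed: "\<And>m. completes_up L m \<Longrightarrow> m \<in> L"
  obtains a b k where "K \<subseteq> up_triangle a b k" "up_triangle a b k \<subseteq> L"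
proof -
  obtain m0 where m0: "m0 \<in> K" using K(2) by blast
  define F where "F = {T. \<exists>a b k. T = up_triangle a b k \<and> m0 \<in> T \<and> T \<subseteq> L}"
  have "{m0} = up_triangle (fst m0) (snd m0) (fst m0 + snd m0)"
    by (cases m0) (auto simp: up_triangle_def)
  then have "{m0} \<in> F" using m0 L(1) unfolding F_def by blast
  moreover have "finite F" by (rule finite_subset[of _ "Pow L"]) (use L(2) in \<open>auto simp: F_def\<close>)
  ultimately obtain T where T: "T \<in> F" "\<And>T'. T' \<in> F \<Longrightarrow> T \<subseteq> T' \<Longrightarrow> T = T'"
    using finite_has_maximal[of F] by blast
  obtain a b k where abk: "T = up_triangle a b k" "m0 \<in> T" "T \<subseteq> L"
    using T(1) by (auto simp: F_def)
  have step: "m \<in> T" if "p \<in> T" "m \<in> L" "adjacent p m" for p m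
  proof (rule ccontr)
    assume "m \<notin> T"
    have "\<exists>a' b' k'. up_triangle a' b' k' \<subseteq> L \<and> T \<subseteq> up_triangle a' b' k' \<and> m \<in> up_triangle a' b' k'"
    proof (rule up_triangle_grow[of L a b k p m])
      show "n \<in> L" if "completes_up L n" for n using closed that .
    qed (use that abk \<open>m \<notin> T\<close> in \<open>simp_all, blast\<close>)
    then obtain T' where "T' \<in> F" "T \<subseteq> T'" "m \<in> T'"
      using abk(2) unfolding F_def by blast
    then show False using T(2)[of T'] \<open>m \<notin> T\<close> by simp
  qed
  have "K \<subseteq> T"
  proof
    fix m assume "m \<in> K"
    then obtain ps where ps: "ps \<noteq> []" "hd ps = m0" "last ps = m" "set ps \<subseteq> K"
      "\<And>i. Suc i < length ps \<Longrightarrow> adjacent (ps ! i) (ps ! Suc i)"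
      using K(1) m0 unfolding connected_pts_def by blast
    have "i < length ps \<Longrightarrow> ps ! i \<in> T" for i
    proof (induction i)
      case 0
      then show ?case using ps(1,2) abk(2) by (simp add: hd_conv_nth)
    next
      case (Suc i)
      moreover have "ps ! Suc i \<in> L" using Suc.prems ps(4) L(1) by (meson nth_mem subsetD)
      ultimately show ?case using step ps(5) by simp
    qed
    from this[of "length ps - 1"] show "m \<in> T" using ps(1,3) by (simp add: last_conv_nth)
  qed
  then show ?thesis using that abk by blast
qed

text \<open>Among the sets between \<open>K\<close> and its bounding triangle whose exposure is at
  most that of \<open>K\<close>, a maximal one is closed under completion. Connectedness then makes
  it the whole bounding triangle.\<close>

lemma exposure_ge_size:
  assumes fin: "finite K" and ne: "K \<noteq> {}" and conn: "connected_pts K"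
  shows "3 * size_pts K + 6 \<le> exposure K"
proof -
  define a where "a = Min (fst ` K)"
  define b where "b = Min (snd ` K)"
  define k where "k = Max ((\<lambda>m. fst m + snd m) ` K)"
  let ?B = "up_triangle a b k"
  have KB: "K \<subseteq> ?B"
  proof
    fix m assume m: "m \<in> K"
    have "a \<le> fst m" "b \<le> snd m" "fst m + snd m \<le> k"
      unfolding a_def b_def k_def using m fin by (auto intro: Min_le Max_ge)
    then show "m \<in> ?B" by (cases m) (simp add: up_triangle_def)
  qed
  have B_least: "?B \<subseteq> up_triangle a' b' k'" if "K \<subseteq> up_triangle a' b' k'" for a' b' k'
  proof -
    have *: "a' \<le> fst m" "b' \<le> snd m" "fst m + snd m \<le> k'" if "m \<in> K" for m
      using \<open>K \<subseteq> up_triangle a' b' k'\<close> that by (force simp: up_triangle_def)+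
    have "a' \<le> a" "b' \<le> b" "k \<le> k'"
      unfolding a_def b_def k_def using fin ne * by auto
    then show ?thesis by (auto simp: up_triangle_def)
  qed
  define F where "F = {L. K \<subseteq> L \<and> L \<subseteq> ?B \<and> exposure L \<le> exposure K}"
  have "finite F"
    by (rule finite_subset[of _ "Pow ?B"]) (auto simp: F_def finite_up_triangle)
  moreover have "K \<in> F" using KB by (simp add: F_def)
  ultimately obtain L where L: "L \<in> F" "\<And>L'. L' \<in> F \<Longrightarrow> L \<subseteq> L' \<Longrightarrow> L = L'"
    using finite_has_maximal[of F] by blast
  have LF: "K \<subseteq> L" "L \<subseteq> ?B" "exposure L \<le> exposure K" using L(1) by (auto simp: F_def)
  have finL: "finite L" using LF(2) finite_up_triangle finite_subset by blast
  have closed: "m \<in> L" if "completes_up L m" for m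
  proof (rule ccontr)
    assume "m \<notin> L"
    then have "exposure (insert m L) \<le> exposure K"
      using exposure_insert_le[OF finL _ that] LF(3) by simp
    \<comment> \<open>Any two corners of an up triangle already satisfy all the inequalities of
      \<open>?B\<close> for the third.\<close>
    moreover have "m \<in> ?B" using that LF(2)
      by (cases m) (force simp: completes_up_def up_triangle_def)
    ultimately have "insert m L \<in> F" using LF by (auto simp: F_def)
    then show False using L(2) \<open>m \<notin> L\<close> by blast
  qed
  obtain a' b' k' where "K \<subseteq> up_triangle a' b' k'" "up_triangle a' b' k' \<subseteq> L"
    using connected_subset_up_triangle[OF conn ne LF(1) finL closed] by blast
  then have "L = ?B" using B_least LF(2) by blast
  moreover have "a + b \<le> k" using KB ne by (force simp: up_triangle_def)
  ultimately show ?thesis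
    using exposure_up_triangle_ge[of a b k] LF(3) by (simp add: size_pts_def a_def b_def k_def)
qed

theorem mainTheorem4:
  fixes D :: "int \<times> int \<Rightarrow> ndval" and d :: int
  assumes "newton_diagram D"
    and "connected_pts (support D)"
    and "size_pts (support D) = d"
  shows "real (num_nodes D) \<ge> (real_of_int d + 5) / 2"
proof -
  have K: "finite (support D)" "support D \<noteq> {}"
    using assms(1) by (auto simp: newton_diagram_def)
  have "3 * d + 6 \<le> exposure (support D)"
    using exposure_ge_size[OF K assms(2)] assms(3) by simp
  moreover have "3 \<le> int (card {a. single_down (support D) a})"
    using three_le_card_single_down[OF K] by simp
  \<comment> \<open>Three times the down count is at least 9; with the exposure this gives 3 d + 15
    \<le> 6 \<open>num_nodes D\<close>.\<close>
  ultimately have "d + 5 \<le> 2 * int (num_nodes D)"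
    using num_nodes_ge_single[OF K(1)] unfolding exposure_def by linarith
  then have "real_of_int (d + 5) \<le> real_of_int (2 * int (num_nodes D))"
    by (simp only: of_int_le_iff)
  then show ?thesis by simp
qed

end
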